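(* Let $(\mathfrak{g},\bullet)$ be an LSPK. Then the following assertions are equivalent: (i) $(\mathfrak{g},\bullet)$ is a Novikov algebra. (ii) $(\mathfrak{g},\bullet)$ is a commutative algebra. (iii) $(\mathfrak{g},\bullet)$ is an associative algebra. Moreover, in this case $(\mathfrak{g},\bullet)$ is isomorphic to $\mathbb{R}^n$ endowed with its canonical associative commutative product $X\bullet Y=(X_1Y_1,\ldots,X_nY_n)$.
   Context: All algebras are real and finite-dimensional. An algebra $(\mathfrak{g},\bullet)$ is left symmetric if $\mathrm{ass}(X,Y,Z)=\mathrm{ass}(Y,X,Z)$ for all $X,Y,Z$, where $\mathrm{ass}(X,Y,Z)=(X\bullet Y)\bullet Z-X\bullet(Y\bullet Z)$. Its Koszul form is the symmetric bilinear form $\mathrm{B}(X,Y)=\mathrm{tr}(\mathrm{L}_{X\bullet Y})$, where $\mathrm{L}_XY=X\bullet Y$. An LSPK is a real left symmetric algebra whose Koszul form is positive definite. A left symmetric algebra is Novikov if $(X\bullet Y)\bullet Z=(X\bullet Z)\bullet Y$ for all $X,Y,Z$. *)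

theory Defs
  imports "HOL-Analysis.Analysis"
begin

text \<open>
  An algebra is given by its product \<open>m\<close> on a type of class \<^class>\<open>real_vector\<close>; the whole
  type is the underlying vector space. Unlike \<^class>\<open>euclidean_space\<close>, this class carries no
  inner product and allows dimension zero.
\<close>

definition fin_dim_algebra :: "('a::real_vector \<Rightarrow> 'a \<Rightarrow> 'a) \<Rightarrow> bool"
  where "fin_dim_algebra m \<longleftrightarrow> bilinear m \<and> (\<exists>B :: 'a set. finite B \<and> span B = UNIV)"

definition associator :: "('a::real_vector \<Rightarrow> 'a \<Rightarrow> 'a) \<Rightarrow> 'a \<Rightarrow> 'a \<Rightarrow> 'a \<Rightarrow> 'a"
  where "associator m x y z = m (m x y) z - m x (m y z)"

definition left_symmetric :: "('a::real_vector \<Rightarrow> 'a \<Rightarrow> 'a) \<Rightarrow> bool"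
  where "left_symmetric m \<longleftrightarrow> fin_dim_algebra m \<and>
    (\<forall>x y z. associator m x y z = associator m y x z)"

text \<open>
  The library only has the trace of a matrix. The trace of an endomorphism of a
  finite-dimensional space is the sum of the diagonal entries of its matrix in some basis;
  lemma \<open>endo_trace_basis\<close> shows that the choice of basis does not matter.
\<close>

definition endo_trace :: "('a::real_vector \<Rightarrow> 'a) \<Rightarrow> real"
  where "endo_trace f =
    (let B = (SOME B. independent B \<and> span B = UNIV) in \<Sum>b\<in>B. representation B (f b) b)"

lemma diagonal_sum_basis_independent:
  fixes f :: "'a::real_vector \<Rightarrow> 'a"
  assumes f: "linear f"
    and B: "finite B" "independent B" "span B = UNIV"
    and C: "finite C" "independent C" "span C = UNIV"
  shows "(\<Sum>b\<in>B. representation B (f b) b) = (\<Sum>c\<in>C. representation C (f c) c)"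
proof -
  have eqB: "(\<Sum>b\<in>B. representation B v b *\<^sub>R b) = v" for v
    using B by (intro real_vector.sum_representation_eq) auto
  have eqC: "(\<Sum>c\<in>C. representation C v c *\<^sub>R c) = v" for v
    using C by (intro real_vector.sum_representation_eq) auto
  have 1: "representation B (f b) b = (\<Sum>c\<in>C. representation C b c * representation B (f c) b)"
    for b
  proof -
    have "f b = f (\<Sum>c\<in>C. representation C b c *\<^sub>R c)" by (simp only: eqC)
    also have "\<dots> = (\<Sum>c\<in>C. representation C b c *\<^sub>R f c)"
      using f by (simp add: linear_sum linear_scale)
    finally have *: "f b = (\<Sum>c\<in>C. representation C b c *\<^sub>R f c)" .
    show ?thesis
      by (subst *) (simp add: B real_vector.representation_sum real_vector.representation_scale)
  qed
  have 2: "representation C (f c) c = (\<Sum>b\<in>B. representation B (f c) b * representation C b c)"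
    for c
    by (subst (1) eqB[of "f c", symmetric])
       (simp add: C real_vector.representation_sum real_vector.representation_scale)
  show ?thesis
    unfolding 2 by (subst sum.swap) (simp add: 1 mult.commute)
qed

lemma endo_trace_basis:
  fixes f :: "'a::real_vector \<Rightarrow> 'a"
  assumes f: "linear f" and B: "finite B" "independent B" "span B = UNIV"
  shows "endo_trace f = (\<Sum>b\<in>B. representation B (f b) b)"
proof -
  define C :: "'a set" where "C = (SOME C. independent C \<and> span C = UNIV)"
  have C: "independent C \<and> span C = UNIV"
    unfolding C_def by (rule someI) (use B in blast)
  then have "finite C"
    using B real_vector.independent_span_bound[of B C] by auto
  then show ?thesis
    using diagonal_sum_basis_independent[OF f B, of C] C
    by (simp add: endo_trace_def C_def[symmetric])
qed

definition koszul_form :: "('a::real_vector \<Rightarrow> 'a \<Rightarrow> 'a) \<Rightarrow> 'a \<Rightarrow> 'a \<Rightarrow> real"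
  where "koszul_form m x y = endo_trace (m (m x y))"

text \<open>
  Symmetry and bilinearity of the Koszul form hold for every left symmetric algebra and are not
  part of the definition.
\<close>

definition LSPK :: "('a::real_vector \<Rightarrow> 'a \<Rightarrow> 'a) \<Rightarrow> bool"
  where "LSPK m \<longleftrightarrow> left_symmetric m \<and> (\<forall>x. x \<noteq> 0 \<longrightarrow> 0 < koszul_form m x x)"

definition novikov_algebra :: "('a::real_vector \<Rightarrow> 'a \<Rightarrow> 'a) \<Rightarrow> bool"
  where "novikov_algebra m \<longleftrightarrow> left_symmetric m \<and> (\<forall>x y z. m (m x y) z = m (m x z) y)"

definition commutative_algebra :: "('a::real_vector \<Rightarrow> 'a \<Rightarrow> 'a) \<Rightarrow> bool"
  where "commutative_algebra m \<longleftrightarrow> fin_dim_algebra m \<and> (\<forall>x y. m x y = m y x)"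

definition associative_algebra :: "('a::real_vector \<Rightarrow> 'a \<Rightarrow> 'a) \<Rightarrow> bool"
  where "associative_algebra m \<longleftrightarrow> fin_dim_algebra m \<and> (\<forall>x y z. m (m x y) z = m x (m y z))"

text \<open>
  The dimension is a value here, so \<open>\<real>\<^sup>n\<close> is represented by the real sequences vanishing from
  index \<open>n\<close> on, with all operations taken componentwise; \<open>n = 0\<close> is allowed.
\<close>

definition Rn :: "nat \<Rightarrow> (nat \<Rightarrow> real) set"
  where "Rn n = {v. \<forall>i\<ge>n. v i = 0}"

definition isomorphic_to_Rn :: "('a::real_vector \<Rightarrow> 'a \<Rightarrow> 'a) \<Rightarrow> nat \<Rightarrow> bool"
  where "isomorphic_to_Rn m n \<longleftrightarrow> (\<exists>\<phi>. bij_betw \<phi> UNIV (Rn n) \<and>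
    (\<forall>x y. \<phi> (x + y) = (\<lambda>i. \<phi> x i + \<phi> y i)) \<and>
    (\<forall>c x. \<phi> (c *\<^sub>R x) = (\<lambda>i. c * \<phi> x i)) \<and>
    (\<forall>x y. \<phi> (m x y) = (\<lambda>i. \<phi> x i * \<phi> y i)))"

end

theory Submission
  imports Defs "HOL-Computational_Algebra.Fundamental_Theorem_Algebra"
begin

text \<open>
  Write \<open>L x\<close> for left multiplication by \<open>x\<close>. Left symmetry says that \<open>L (x y - y x)\<close> is the
  commutator of \<open>L x\<close> and \<open>L y\<close>; since commutators have trace zero, the Koszul form \<open>K\<close> is
  symmetric. The argument then rests on finding multiplications that are self-adjoint for \<open>K\<close>.

  In a Novikov algebra, \<open>(x y) z = (x z) y\<close> makes each \<open>L x\<close> self-adjoint for \<open>K\<close>. For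
  \<open>c = x y - y x\<close> the operator \<open>L c\<close> is then self-adjoint, and skew-adjoint because it is a
  commutator of self-adjoint operators. So \<open>L c = 0\<close>, and \<open>K c c = 0\<close> forces \<open>c = 0\<close>: this is
  \<open>LSPK_novikov_imp_commutative\<close>. A commutative left symmetric algebra is associative because
  all \<open>L x\<close> commute, and a commutative associative algebra is trivially Novikov.

  The remaining implication, from associative to commutative, and the isomorphism with \<open>\<real>\<^sup>n\<close>
  are obtained together, from a basis of orthogonal idempotents
  (\<open>spanning_orthogonal_idempotents\<close>). Positivity excludes non-zero elements of square zero, and
  this makes idempotents central. Given \<open>v \<noteq> 0\<close>, multiplication by \<open>v\<close> is self-adjoint on the
  span of the powers of \<open>v\<close>, so it has an eigenvector \<open>w\<close> that is itself a polynomial in \<open>v\<close>; then \<open>w w\<close> is a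
  multiple of \<open>w\<close>, non-zero by positivity, and rescaling \<open>w\<close> gives an idempotent
  (\<open>idempotent_in_right_ideal\<close>). A family of orthogonal idempotents of maximal size can be
  neither enlarged nor refined by such idempotents, so it is a basis. Its elements are central,
  so the algebra is commutative, and the coordinates in this basis multiply componentwise.

  The real eigenvalue is found algebraically: a real polynomial annihilating a vector splits off
  factors of degree one or two, and a factor without real roots cannot annihilate a non-zero
  vector when the operator is self-adjoint.
\<close>

section \<open>Traces and commutators\<close>

lemma finite_dim_basis:
  fixes F :: "'a::real_vector set"
  assumes "finite F" "span F = UNIV"
  obtains B :: "'a set" where "finite B" "independent B" "span B = UNIV"
proof -
  obtain B where B: "B \<subseteq> F" "independent B" "F \<subseteq> span B"
    using real_vector.maximal_independent_subset[of F] by auto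
  have "span B = UNIV"
    using B(3) assms(2) by (metis real_vector.span_minimal real_vector.subspace_span top.extremum_unique)
  with B assms(1) show thesis
    using that finite_subset by blast
qed

lemma endo_trace_add:
  fixes f g :: "'a::real_vector \<Rightarrow> 'a"
  assumes "finite F" "span F = (UNIV :: 'a set)" "linear f" "linear g"
  shows "endo_trace (\<lambda>x. f x + g x) = endo_trace f + endo_trace g"
proof -
  obtain B :: "'a set" where B: "finite B" "independent B" "span B = UNIV"
    using finite_dim_basis assms(1,2) by blast
  have "linear (\<lambda>x. f x + g x)"
    using assms by (simp add: linear_compose_add)
  then show ?thesis
    using assms B by (simp add: endo_trace_basis[OF _ B] real_vector.representation_add sum.distrib)
qed

lemma endo_trace_scaleR:
  fixes f :: "'a::real_vector \<Rightarrow> 'a"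
  assumes "finite F" "span F = (UNIV :: 'a set)" "linear f"
  shows "endo_trace (\<lambda>x. c *\<^sub>R f x) = c * endo_trace f"
proof -
  obtain B :: "'a set" where B: "finite B" "independent B" "span B = UNIV"
    using finite_dim_basis assms(1,2) by blast
  have "linear (\<lambda>x. c *\<^sub>R f x)"
    using assms by (simp add: linear_compose_scale_right)
  then show ?thesis
    using assms B by (simp add: endo_trace_basis[OF _ B] real_vector.representation_scale sum_distrib_left)
qed

lemma endo_trace_comp_commute:
  fixes f g :: "'a::real_vector \<Rightarrow> 'a"
  assumes "finite F" "span F = (UNIV :: 'a set)" "linear f" "linear g"
  shows "endo_trace (\<lambda>x. f (g x)) = endo_trace (\<lambda>x. g (f x))"
proof -
  obtain B :: "'a set" where B: "finite B" "independent B" "span B = UNIV"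
    using finite_dim_basis assms(1,2) by blast
  have exp: "representation B (h (k b)) b = (\<Sum>c\<in>B. representation B (k b) c * representation B (h c) b)"
    if "linear h" for h k :: "'a \<Rightarrow> 'a" and b
  proof -
    have "k b = (\<Sum>c\<in>B. representation B (k b) c *\<^sub>R c)"
      using B by (intro real_vector.sum_representation_eq[symmetric]) auto
    then have "h (k b) = (\<Sum>c\<in>B. representation B (k b) c *\<^sub>R h c)"
      using that by (metis (no_types, lifting) linear_sum linear_scale sum.cong)
    then show ?thesis
      by (simp add: B real_vector.representation_sum real_vector.representation_scale)
  qed
  have lin: "linear (\<lambda>x. f (g x))" "linear (\<lambda>x. g (f x))"
    using linear_compose[OF assms(4,3)] linear_compose[OF assms(3,4)] by (simp_all add: o_def)
  show ?thesis
    unfolding endo_trace_basis[OF lin(1) B] endo_trace_basis[OF lin(2) B]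
      exp[OF assms(3), where k = g] exp[OF assms(4), where k = f]
    by (subst sum.swap) (simp add: mult.commute)
qed

section \<open>Polynomials in an endomorphism\<close>

text \<open>
  This is \<open>p(T) v\<close>, evaluated by Horner's rule. Applied to multiplication by a complex number and the vector \<open>1\<close>, it is evaluation of a
  real polynomial at that number.
\<close>

definition poly_op :: "('a::real_vector \<Rightarrow> 'a) \<Rightarrow> real poly \<Rightarrow> 'a \<Rightarrow> 'a"
  where "poly_op T p v = fold_coeffs (\<lambda>c w. c *\<^sub>R v + T w) p 0"

lemma poly_op_0 [simp]: "poly_op T 0 v = 0"
  by (simp add: poly_op_def)

lemma poly_op_pCons:
  "linear T \<Longrightarrow> poly_op T (pCons c p) v = c *\<^sub>R v + T (poly_op T p v)"
  by (cases "c = 0 \<and> p = 0") (auto simp: poly_op_def linear_0)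

lemma poly_op_add:
  assumes "linear T"
  shows "poly_op T (p + q) v = poly_op T p v + poly_op T q v"
proof (induction p arbitrary: q rule: pCons_induct)
  case 0
  show ?case by simp
next
  case (pCons a p)
  obtain b r where "q = pCons b r" by (cases q)
  then show ?case
    using pCons.IH assms by (simp add: poly_op_pCons scaleR_add_left linear_add)
qed

lemma poly_op_smult: "linear T \<Longrightarrow> poly_op T (smult c p) v = c *\<^sub>R poly_op T p v"
  by (induction p rule: pCons_induct) (simp_all add: poly_op_pCons scaleR_add_right linear_scale)

lemma poly_op_mult: "linear T \<Longrightarrow> poly_op T (p * q) v = poly_op T p (poly_op T q v)"
  by (induction p rule: pCons_induct) (simp_all add: poly_op_pCons poly_op_add poly_op_smult)

lemma poly_op_at_0: "linear T \<Longrightarrow> poly_op T p 0 = 0"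
  by (induction p rule: pCons_induct) (simp_all add: poly_op_pCons linear_0)

lemma poly_op_sum:
  "linear T \<Longrightarrow> poly_op T (\<Sum>i\<in>I. p i) v = (\<Sum>i\<in>I. poly_op T (p i) v)"
  by (induction I rule: infinite_finite_induct) (simp_all add: poly_op_add)

lemma poly_op_monom:
  assumes "linear T" shows "poly_op T (monom c i) v = c *\<^sub>R (T ^^ i) v"
  using assms by (induction i) (simp_all add: monom_0 monom_Suc poly_op_pCons linear_0 linear_scale)

lemma poly_op_in_invariant_subspace:
  assumes "linear T" "subspace W" "\<And>x. x \<in> W \<Longrightarrow> T x \<in> W" "v \<in> W"
  shows "poly_op T p v \<in> W"
  using assms
  by (induction p rule: pCons_induct)
    (simp_all add: poly_op_pCons real_vector.subspace_0 real_vector.subspace_add real_vector.subspace_scale)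

text \<open>
  The iterates \<open>v\<close>, \<open>T v\<close>, \<open>T (T v)\<close>, ... cannot all be independent: either two of them coincide, or
  the first \<open>card F + 1\<close> of them satisfy a linear relation, whose coefficients give the polynomial.
\<close>

lemma annihilating_polynomial_exists:
  fixes T :: "'a::real_vector \<Rightarrow> 'a"
  assumes F: "finite F" "span F = (UNIV :: 'a set)" and T: "linear T"
  obtains p where "p \<noteq> 0" "poly_op T p v = 0"
proof -
  define g where "g i = (T ^^ i) v" for i
  define I where "I = {..card F}"
  show thesis
  proof (cases "inj_on g I")
    case False
    then obtain i j where ij: "g i = g j" "i \<noteq> j"
      unfolding inj_on_def by blast
    let ?p = "monom 1 i + monom (- 1) j :: real poly"
    have "coeff ?p i = 1" using ij by simp
    then have "?p \<noteq> 0" by (metis coeff_0 zero_neq_one)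
    moreover have "poly_op T ?p v = 0"
      using ij(1) T by (simp add: poly_op_add poly_op_monom g_def)
    ultimately show thesis using that by blast
  next
    case True
    have "card (g ` I) = Suc (card F)"
      using True by (simp add: card_image I_def)
    then have "dependent (g ` I)"
      using real_vector.independent_span_bound[OF F(1), of "g ` I"] F(2) by auto
    then obtain u where u: "\<exists>w\<in>g ` I. u w \<noteq> 0" "(\<Sum>w\<in>g ` I. u w *\<^sub>R w) = 0"
      using real_vector.dependent_finite[of "g ` I"] by (auto simp: I_def)
    then obtain j where j: "j \<in> I" "u (g j) \<noteq> 0" by blast
    let ?p = "\<Sum>i\<in>I. monom (u (g i)) i"
    have "coeff ?p j = u (g j)"
      using j by (simp add: coeff_sum I_def)
    then have "?p \<noteq> 0" using j by (metis coeff_0)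
    moreover have "poly_op T ?p v = 0"
      using u(2) T by (simp add: poly_op_sum poly_op_monom sum.reindex[OF True] g_def[symmetric])
    ultimately show thesis using that by blast
  qed
qed

lemma poly_op_complex_mult:
  "poly_op (\<lambda>w. z * w) p 1 = poly (map_poly complex_of_real p) z"
proof -
  have "linear (\<lambda>w. z * w)"
    by (simp add: linear_iff algebra_simps)
  then show ?thesis
    by (induction p rule: pCons_induct)
      (simp_all add: poly_op_pCons map_poly_pCons scaleR_conv_of_real)
qed

text \<open>
  A complex root \<open>z\<close> of \<open>p\<close> exists by the fundamental theorem of algebra. Its minimal polynomial
  over the reals divides \<open>p\<close>, since the remainder vanishes at \<open>z\<close> and has smaller degree.
\<close>

lemma real_poly_low_degree_divisor:
  fixes p :: "real poly"
  assumes "degree p \<noteq> 0"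
  obtains a where "[:- a, 1:] dvd p"
    | a b where "b \<noteq> 0" "[:a\<^sup>2 + b\<^sup>2, - 2 * a, 1:] dvd p"
proof -
  let ?P = "map_poly complex_of_real p"
  have "degree ?P = degree p"
    by (simp add: degree_map_poly)
  then have "\<not> (\<exists>a l. a \<noteq> 0 \<and> l = 0 \<and> ?P = pCons a l)"
    using assms by auto
  then obtain z where z: "poly ?P z = 0"
    using fundamental_theorem_of_algebra_alt by blast
  define ev where "ev q = poly_op (\<lambda>w. z * w) q 1" for q
  have lin: "linear (\<lambda>w. z * w)"
    by (simp add: linear_iff algebra_simps)
  have ev_linear: "ev [:c, d:] = of_real c + of_real d * z" for c d
    using lin by (simp add: ev_def poly_op_pCons scaleR_conv_of_real mult.commute)
  define q where
    "q = (if Im z = 0 then [:- Re z, 1:] else [:(Re z)\<^sup>2 + (Im z)\<^sup>2, - 2 * Re z, 1:])"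
  have q0: "q \<noteq> 0" by (simp add: q_def)
  have "ev q = 0"
    using lin by (simp add: ev_def q_def poly_op_pCons complex_eq_iff power2_eq_square algebra_simps)
  moreover have "ev p = 0"
    using z by (simp add: ev_def poly_op_complex_mult)
  moreover have "ev p = ev (p div q * q) + ev (p mod q)"
    unfolding ev_def by (simp add: poly_op_add[OF lin, symmetric])
  moreover have "ev (p div q * q) = 0"
    using \<open>ev q = 0\<close> lin by (simp add: ev_def poly_op_mult poly_op_at_0)
  ultimately have mod0: "ev (p mod q) = 0" by simp
  have "q dvd p"
  proof (rule ccontr)
    assume "\<not> q dvd p"
    then have deg: "degree (p mod q) < degree q" and ne: "p mod q \<noteq> 0"
      using degree_mod_less_degree[OF q0] by (auto simp: dvd_eq_mod_eq_0)
    then have "degree (p mod q) \<le> 1"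
      by (auto simp: q_def split: if_splits)
    then have "p mod q = [:coeff (p mod q) 0, coeff (p mod q) 1:]"
      by (intro poly_eqI) (auto simp: coeff_pCons coeff_eq_0 split: nat.splits)
    then obtain c d where cd: "p mod q = [:c, d:]" by blast
    show False
    proof (cases "Im z = 0")
      case True
      then have "d = 0" using deg cd by (simp add: q_def split: if_splits)
      then show False using mod0 ne cd ev_linear[of c 0] by simp
    next
      case False
      have "d * Im z = 0" using mod0 cd by (simp add: ev_linear complex_eq_iff)
      with False have "d = 0" by simp
      then show False using mod0 ne cd ev_linear[of c 0] by simp
    qed
  qed
  then show thesis
    using that by (cases "Im z = 0") (auto simp: q_def)
qed


section \<open>Eigenvectors of self-adjoint operators\<close>

text \<open>
  Among the annihilating polynomials, go down in degree: write \<open>p = q r\<close> with \<open>q\<close> of degree one or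
  two. Either \<open>r\<close> already annihilates \<open>v\<close>, or \<open>u = r(T) v\<close> is a non-zero vector killed by \<open>q(T)\<close>.
  For linear \<open>q\<close> this is an eigenvector. For \<open>q = (X - a)\<^sup>2 + b\<^sup>2\<close> with \<open>b \<noteq> 0\<close>, self-adjointness
  turns \<open>q(T) u = 0\<close> into \<open>B (T u - a u) (T u - a u) = - b\<^sup>2 B u u < 0\<close>, which is absurd.
  Self-adjointness is required on \<open>W\<close> only, because left multiplications in an associative algebra
  need not be self-adjoint on the whole algebra.
\<close>

lemma self_adjoint_eigenvector:
  fixes T :: "'a::real_vector \<Rightarrow> 'a" and B :: "'a \<Rightarrow> 'a \<Rightarrow> real"
  assumes fin: "finite F" "span F = (UNIV :: 'a set)"
    and B: "bilinear B" "\<And>x. x \<noteq> 0 \<Longrightarrow> 0 < B x x"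
    and T: "linear T"
    and W: "subspace W" "\<And>x. x \<in> W \<Longrightarrow> T x \<in> W"
    and self_adjoint: "\<And>x y. x \<in> W \<Longrightarrow> y \<in> W \<Longrightarrow> B (T x) y = B x (T y)"
    and v: "v \<in> W" "v \<noteq> 0"
  obtains w c where "w \<in> W" "w \<noteq> 0" "T w = c *\<^sub>R w"
proof -
  have "\<exists>w\<in>W. \<exists>c. w \<noteq> 0 \<and> T w = c *\<^sub>R w" if "p \<noteq> 0" "poly_op T p v = 0" for p
    using that
  proof (induction "degree p" arbitrary: p rule: less_induct)
    case less
    have split: ?case if "p = q * r" "degree q \<noteq> 0"
      and eig: "\<And>u. u \<in> W \<Longrightarrow> u \<noteq> 0 \<Longrightarrow> poly_op T q u = 0 \<Longrightarrow> \<exists>c. T u = c *\<^sub>R u" for q r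
    proof (cases "poly_op T r v = 0")
      case True
      have "q \<noteq> 0" "r \<noteq> 0" using less.prems that by auto
      then have "degree r < degree p" using that by (simp add: degree_mult_eq)
      then show ?thesis using less.hyps \<open>r \<noteq> 0\<close> True by blast
    next
      case False
      have "poly_op T r v \<in> W"
        using poly_op_in_invariant_subspace T W v(1) by blast
      then show ?thesis
        using False eig less.prems(2) that(1) T by (metis poly_op_mult)
    qed
    have "degree p \<noteq> 0"
    proof
      assume "degree p = 0"
      then obtain c where "p = [:c:]" by (rule degree_eq_zeroE)
      then show False using less.prems v T by (simp add: poly_op_pCons linear_0)
    qed
    then show ?case
    proof (cases rule: real_poly_low_degree_divisor)
      case (1 a)
      then obtain r where "p = [:- a, 1:] * r" by (auto elim: dvdE)
      moreover have "\<exists>c. T u = c *\<^sub>R u" if "poly_op T [:- a, 1:] u = 0" for u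
        using that T by (auto simp: poly_op_pCons linear_0 intro!: exI[of _ a])
      ultimately show ?thesis by (intro split) auto
    next
      case (2 a b)
      then obtain r where "p = [:a\<^sup>2 + b\<^sup>2, - 2 * a, 1:] * r" by (auto elim: dvdE)
      moreover have False
        if u: "u \<in> W" "u \<noteq> 0" "poly_op T [:a\<^sup>2 + b\<^sup>2, - 2 * a, 1:] u = 0" for u
      proof -
        have TTu: "T (T u) = (2 * a) *\<^sub>R T u - (a\<^sup>2 + b\<^sup>2) *\<^sub>R u"
          using u(3) T by (simp add: poly_op_pCons linear_0 linear_add linear_diff linear_scale algebra_simps)
        note bil = bilinear_lsub[OF B(1)] bilinear_rsub[OF B(1)] bilinear_lmul[OF B(1)] bilinear_rmul[OF B(1)]
        have "B (T u) (T u) = B u (T (T u))"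
          using self_adjoint u(1) W(2) by blast
        also have "\<dots> = 2 * a * B u (T u) - (a\<^sup>2 + b\<^sup>2) * B u u"
          by (simp add: TTu bil)
        finally have "B (T u - a *\<^sub>R u) (T u - a *\<^sub>R u) = - (b\<^sup>2 * B u u)"
          using self_adjoint[OF u(1,1)] by (simp add: bil power2_eq_square algebra_simps)
        moreover have "0 < b\<^sup>2 * B u u"
          using 2 B(2)[OF u(2)] by simp
        moreover have "0 \<le> B x x" for x
          using B(2)[of x] bilinear_lzero[OF B(1), of x] by (cases "x = 0") auto
        ultimately show False
          by (metis neg_0_le_iff_le not_le)
      qed
      ultimately show ?thesis by (intro split) auto
    qed
  qed
  then show thesis
    using annihilating_polynomial_exists[OF fin T] that by metis
qed

section \<open>Associative algebras with a positive definite trace form\<close>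

text \<open>
  The functional \<open>tr\<close> stands for \<open>x \<mapsto> trace (L x)\<close>, so that \<open>tr (x y)\<close> is the Koszul form.
\<close>

locale positive_trace_algebra =
  fixes m :: "'a::real_vector \<Rightarrow> 'a \<Rightarrow> 'a" and tr :: "'a \<Rightarrow> real"
  assumes fin_dim: "fin_dim_algebra m"
    and assoc: "m (m x y) z = m x (m y z)"
    and linear_tr: "linear tr"
    and tr_commute: "tr (m x y) = tr (m y x)"
    and tr_pos: "x \<noteq> 0 \<Longrightarrow> 0 < tr (m x x)"
begin

lemma bilinear_m: "bilinear m"
  using fin_dim by (simp add: fin_dim_algebra_def)

lemmas m_simps =
  bilinear_ladd[OF bilinear_m] bilinear_radd[OF bilinear_m]
  bilinear_lsub[OF bilinear_m] bilinear_rsub[OF bilinear_m]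
  bilinear_lmul[OF bilinear_m] bilinear_rmul[OF bilinear_m]
  bilinear_lzero[OF bilinear_m] bilinear_rzero[OF bilinear_m]

lemma square_zero_imp_zero: "m x x = 0 \<Longrightarrow> x = 0"
  using tr_pos[of x] linear_0[OF linear_tr] by fastforce

text \<open>
  Both \<open>e x - e x e\<close> and \<open>x e - e x e\<close> have square zero, so \<open>e x = e x e = x e\<close>.
\<close>

lemma idempotent_central:
  assumes "m e e = e"
  shows "m e x = m x e"
proof -
  have ee: "m e (m e y) = m e y" for y
    by (metis assms assoc)
  have "m e x - m e (m x e) = 0"
    by (rule square_zero_imp_zero) (simp add: m_simps assoc ee assms)
  moreover have "m x e - m e (m x e) = 0"
    by (rule square_zero_imp_zero) (simp add: m_simps assoc ee assms)
  ultimately show ?thesis by simp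
qed

text \<open>
  The subspace \<open>W\<close> below is a substitute for the polynomials in \<open>v\<close> without constant term: it
  contains \<open>v\<close>, is stable under multiplication by \<open>v\<close>, commutes with \<open>v\<close>, and every eigenvector of
  \<open>L v\<close> is an eigenvector of all its elements. On \<open>W\<close> the operator \<open>L v\<close> is self-adjoint; an
  eigenvector \<open>w\<close> in \<open>W\<close> satisfies \<open>w w = d w\<close>, as \<open>w\<close> acts on \<open>w\<close> by a scalar.
  That the idempotent is also an eigenvector of \<open>L v\<close> serves to distinguish it from a
  given idempotent of which \<open>v\<close> is not a multiple.
\<close>

lemma idempotent_in_right_ideal:
  assumes S: "subspace S" "\<And>x y. x \<in> S \<Longrightarrow> m x y \<in> S" and v: "v \<in> S" "v \<noteq> 0"
  obtains e c where "e \<in> S" "e \<noteq> 0" "m e e = e" "m v e = c *\<^sub>R e"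
proof -
  define W where "W = {x \<in> S. m v x = m x v \<and>
    (\<forall>w c. m v w = c *\<^sub>R w \<longrightarrow> (\<exists>d. m x w = d *\<^sub>R w))}"
  obtain F :: "'a set" where F: "finite F" "span F = UNIV"
    using fin_dim by (auto simp: fin_dim_algebra_def)
  have bil: "bilinear (\<lambda>x y. tr (m x y))"
    using linear_tr by (simp add: bilinear_def linear_iff m_simps)
  have lin: "linear (m v)"
    using bilinear_m by (simp add: bilinear_def)
  have sub: "subspace W"
    unfolding real_vector.subspace_def
  proof (intro conjI ballI allI)
    show "0 \<in> W"
      using S(1) by (auto simp: W_def m_simps real_vector.subspace_0 intro: exI[of _ 0])
  next
    fix x y assume "x \<in> W" "y \<in> W"
    then show "x + y \<in> W"
      using S(1) unfolding W_def
      by (auto simp: m_simps real_vector.subspace_add) (metis scaleR_add_left)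
  next
    fix a x assume "x \<in> W"
    then show "a *\<^sub>R x \<in> W"
      using S(1) unfolding W_def
      by (auto simp: m_simps real_vector.subspace_scale)
  qed
  have inv: "m v x \<in> W" if "x \<in> W" for x
  proof -
    have "m v (m v x) = m (m v x) v"
      using that assoc[of v x v] by (simp add: W_def)
    moreover have "\<exists>d. m (m v x) w = d *\<^sub>R w" if w: "m v w = c *\<^sub>R w" for w c
    proof -
      obtain d where "m x w = d *\<^sub>R w"
        using \<open>x \<in> W\<close> w by (auto simp: W_def)
      then have "m (m v x) w = (d * c) *\<^sub>R w"
        using w by (simp add: assoc m_simps)
      then show ?thesis ..
    qed
    moreover have "m v x \<in> S"
      using S(2) v(1) by blast
    ultimately show ?thesis
      unfolding W_def by blast
  qed
  have "v \<in> W"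
    using v(1) by (auto simp: W_def)
  moreover have "tr (m (m v x) y) = tr (m x (m v y))" if "x \<in> W" "y \<in> W" for x y
    using that assoc[of x v y] by (simp add: W_def)
  ultimately obtain w c where w: "w \<in> W" "w \<noteq> 0" "m v w = c *\<^sub>R w"
    using self_adjoint_eigenvector[OF F bil tr_pos lin sub inv] v(2) by blast
  then obtain d where d: "m w w = d *\<^sub>R w"
    unfolding W_def by blast
  have "d \<noteq> 0"
    using d w(2) square_zero_imp_zero[of w] by auto
  show thesis
  proof
    show "(1 / d) *\<^sub>R w \<in> S"
      using w(1) S(1) by (auto simp: W_def real_vector.subspace_scale)
    show "(1 / d) *\<^sub>R w \<noteq> 0"
      using w(2) \<open>d \<noteq> 0\<close> by simp
    show "m ((1 / d) *\<^sub>R w) ((1 / d) *\<^sub>R w) = (1 / d) *\<^sub>R w"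
      using \<open>d \<noteq> 0\<close> by (simp add: m_simps d)
    show "m v ((1 / d) *\<^sub>R w) = c *\<^sub>R ((1 / d) *\<^sub>R w)"
      using w(3) by (simp add: m_simps)
  qed
qed

definition orthogonal_idempotents :: "'a set \<Rightarrow> bool"
  where "orthogonal_idempotents E \<longleftrightarrow> finite E \<and> 0 \<notin> E \<and>
    (\<forall>e\<in>E. \<forall>f\<in>E. m e f = (if e = f then e else 0))"

lemma m_orthogonal_sum:
  assumes "orthogonal_idempotents E" "e \<in> E"
  shows "m e (\<Sum>f\<in>E. u f *\<^sub>R f) = u e *\<^sub>R e"
proof -
  have lin: "linear (m e)"
    using bilinear_m by (simp add: bilinear_def)
  have "m e (\<Sum>f\<in>E. u f *\<^sub>R f) = (\<Sum>f\<in>E. if e = f then u f *\<^sub>R e else 0)"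
    unfolding linear_sum[OF lin] using assms
    by (intro sum.cong) (auto simp: orthogonal_idempotents_def m_simps)
  also have "\<dots> = u e *\<^sub>R e"
    using assms by (simp add: orthogonal_idempotents_def)
  finally show ?thesis .
qed

lemma orthogonal_idempotents_independent:
  assumes E: "orthogonal_idempotents E"
  shows "independent E"
proof (rule real_vector.independent_if_scalars_zero)
  show "finite E" using E by (simp add: orthogonal_idempotents_def)
next
  fix u e assume "(\<Sum>x\<in>E. u x *\<^sub>R x) = 0" "e \<in> E"
  then have "u e *\<^sub>R e = 0"
    using m_orthogonal_sum[OF E, of e u] by (simp add: m_simps)
  moreover have "e \<noteq> 0" using E \<open>e \<in> E\<close> by (auto simp: orthogonal_idempotents_def)
  ultimately show "u e = 0" by simp
qed

text \<open>
  Take a family \<open>E\<close> of maximal cardinality, which exists because orthogonal idempotents are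
  independent. An idempotent in the annihilator of \<open>E\<close> could be added to \<open>E\<close>, so the annihilator is
  zero, and then \<open>x = (\<Sum>e\<in>E. e x)\<close> for all \<open>x\<close>. If some \<open>e x\<close> were not a multiple of \<open>e\<close>, the ideal
  of \<open>e\<close> would contain an idempotent \<open>f \<noteq> e\<close>, and \<open>e\<close> could be replaced by the two idempotents
  \<open>f\<close> and \<open>e - f\<close>.
\<close>

lemma spanning_orthogonal_idempotents:
  obtains E where "orthogonal_idempotents E" "span E = UNIV"
proof -
  obtain F :: "'a set" where F: "finite F" "span F = UNIV"
    using fin_dim by (auto simp: fin_dim_algebra_def)
  have "orthogonal_idempotents {}"
    by (simp add: orthogonal_idempotents_def)
  moreover have "card E < Suc (card F)" if "orthogonal_idempotents E" for E
    using real_vector.independent_span_bound[OF F(1) orthogonal_idempotents_independent[OF that]] F(2)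
    by simp
  ultimately obtain E where E: "orthogonal_idempotents E"
    and max: "\<And>E'. orthogonal_idempotents E' \<Longrightarrow> card E' \<le> card E"
    using ex_has_greatest_nat[of orthogonal_idempotents "{}" card "Suc (card F)"] by blast
  have fin: "finite E"
    using E by (simp add: orthogonal_idempotents_def)
  define S where "S = {x. \<forall>e\<in>E. m e x = 0}"
  have S: "subspace S" "\<And>x y. x \<in> S \<Longrightarrow> m x y \<in> S"
    by (auto simp: S_def real_vector.subspace_def m_simps assoc[symmetric])
  have S0: "v = 0" if v: "v \<in> S" for v
  proof (rule ccontr)
    assume "v \<noteq> 0"
    then obtain e where e: "e \<in> S" "e \<noteq> 0" "m e e = e"
      using idempotent_in_right_ideal[OF S v] by metis
    have orth: "m f e = 0" "m e f = 0" if "f \<in> E" for f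
      using that e(1) idempotent_central[OF e(3), of f] by (auto simp: S_def)
    then have "e \<notin> E" using e by force
    moreover have "orthogonal_idempotents (insert e E)"
      using E e orth by (auto simp: orthogonal_idempotents_def)
    ultimately show False
      using max[of "insert e E"] fin by simp
  qed
  have sum: "x = (\<Sum>e\<in>E. m e x)" for x
  proof -
    have "m f (\<Sum>e\<in>E. m e x) = m f x" if "f \<in> E" for f
    proof -
      have lin: "linear (m f)"
        using bilinear_m by (simp add: bilinear_def)
      have "m f (\<Sum>e\<in>E. m e x) = (\<Sum>e\<in>E. if f = e then m e x else 0)"
        unfolding linear_sum[OF lin] using E that
        by (intro sum.cong) (auto simp: orthogonal_idempotents_def assoc[symmetric] m_simps)
      then show ?thesis using fin that by simp
    qed
    then have "x - (\<Sum>e\<in>E. m e x) \<in> S" by (simp add: S_def m_simps)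
    then show ?thesis using S0 by fastforce
  qed
  have scalar: "m e x \<in> span {e}" if e: "e \<in> E" for e x
  proof (rule ccontr)
    assume notin: "m e x \<notin> span {e}"
    have ee: "m e e = e" "m e (m e y) = m e y" for y
      using E e assoc[of e e y] by (auto simp: orthogonal_idempotents_def)
    define P where "P = {y. m e y = y}"
    have P: "subspace P" "\<And>x y. x \<in> P \<Longrightarrow> m x y \<in> P"
      by (auto simp: P_def real_vector.subspace_def m_simps assoc[symmetric])
    have "m e x \<in> P" "m e x \<noteq> 0"
      using notin by (auto simp: P_def ee real_vector.span_zero)
    then obtain f c where f: "f \<in> P" "f \<noteq> 0" "m f f = f" "m (m e x) f = c *\<^sub>R f"
      using idempotent_in_right_ideal[OF P] by metis
    \<comment> \<open>For \<open>f = e\<close> the eigenvalue equation would make \<open>e x = (e x) e\<close> a multiple of \<open>e\<close>.\<close>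
    have "f \<noteq> e"
    proof
      assume "f = e"
      then have "m e x = c *\<^sub>R e"
        using f(4) ee idempotent_central[OF ee(1), of "m e x"] by simp
      then show False
        using notin by (simp add: real_vector.span_base real_vector.span_scale)
    qed
    have ef: "m e f = f" "m f e = f"
      using f(1) idempotent_central[OF f(3), of e] by (auto simp: P_def)
    have orth: "m g f = 0" "m f g = 0" "m g e = 0" "m e g = 0" if "g \<in> E - {e}" for g
    proof -
      show "m g e = 0" "m e g = 0"
        using E e that by (auto simp: orthogonal_idempotents_def)
      then show "m g f = 0" "m f g = 0"
        using ef assoc[of g e f] assoc[of f e g] by (simp_all add: m_simps)
    qed
    let ?E = "insert f (insert (e - f) (E - {e}))"
    have f_diff: "m f (e - f) = 0" "m (e - f) f = 0" "m (e - f) e = e - f" "m (e - f) (e - f) = e - f"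
      using f(3) ef ee(1) by (simp_all add: m_simps)
    have f_new: "f \<notin> E - {e}" using orth(1)[of f] f(2,3) by auto
    moreover have diff_new: "e - f \<notin> E - {e}"
      using orth(3)[of "e - f"] f_diff(3) \<open>f \<noteq> e\<close> by auto
    moreover have "f \<noteq> e - f" using f_diff(1) f(2,3) by metis
    ultimately have "card ?E = Suc (card E)"
      using fin e card_Suc_Diff1[OF fin e] by simp
    moreover have "orthogonal_idempotents ?E"
      unfolding orthogonal_idempotents_def
    proof (intro conjI ballI)
      show "finite ?E" using fin by simp
      show "0 \<notin> ?E" using E f(2) \<open>f \<noteq> e\<close> by (auto simp: orthogonal_idempotents_def)
      have old: "m g h = (if g = h then g else 0)" if "g \<in> E - {e}" "h \<in> E - {e}" for g h
        using E that by (simp add: orthogonal_idempotents_def)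
      have diff: "m g (e - f) = 0" "m (e - f) g = 0" if "g \<in> E - {e}" for g
        using orth[OF that] by (simp_all add: m_simps)
      fix g h assume "g \<in> ?E" "h \<in> ?E"
      then consider "g = f" | "g = e - f" | "g \<in> E - {e}" by blast
      then show "m g h = (if g = h then g else 0)"
      proof cases
        case 1
        with \<open>h \<in> ?E\<close> show ?thesis using orth(2) f(3) f_diff(1) by auto
      next
        case 2
        with \<open>h \<in> ?E\<close> show ?thesis using diff(2) f_diff(2,4) by auto
      next
        case 3
        from \<open>h \<in> ?E\<close> consider "h = f" | "h = e - f" | "h \<in> E - {e}" by blast
        then show ?thesis
        proof cases
          case h: 1
          then show ?thesis using orth(1)[OF 3] 3 f_new by auto
        next
          case h: 2
          then show ?thesis using diff(1)[OF 3] 3 diff_new by auto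
        next
          case h: 3
          show ?thesis by (rule old[OF 3 h])
        qed
      qed
    qed
    ultimately show False
      using max[of ?E] by simp
  qed
  have "x \<in> span E" for x
  proof -
    have "m e x \<in> span E" if "e \<in> E" for e
      using scalar[OF that] real_vector.span_mono[of "{e}" E] that by blast
    then have "(\<Sum>e\<in>E. m e x) \<in> span E"
      by (rule real_vector.span_sum)
    then show ?thesis
      using sum[of x] by simp
  qed
  then show thesis
    using that E by blast
qed

lemma commutative: "m x y = m y x"
proof -
  obtain E where E: "orthogonal_idempotents E" "span E = UNIV"
    by (rule spanning_orthogonal_idempotents)
  have "x \<in> span E" using E(2) by simp
  then show ?thesis
  proof (induction rule: real_vector.span_induct_alt)
    case base
    show ?case by (simp add: m_simps)
  next
    case (step c e z)
    then have "m e y = m y e"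
      using E(1) by (intro idempotent_central) (auto simp: orthogonal_idempotents_def)
    then show ?case using step by (simp add: m_simps)
  qed
qed

lemma isomorphic_to_Rn: "isomorphic_to_Rn m (dim (UNIV :: 'a set))"
proof -
  obtain E where E: "orthogonal_idempotents E" "span E = UNIV"
    by (rule spanning_orthogonal_idempotents)
  have fin: "finite E" using E(1) by (simp add: orthogonal_idempotents_def)
  have ind: "independent E" by (rule orthogonal_idempotents_independent[OF E(1)])
  let ?n = "dim (UNIV :: 'a set)"
  have "?n = card E"
    using real_vector.dim_eq_card[of E UNIV] E(2) ind by simp
  then obtain h where h: "bij_betw h {..<?n} E"
    using ex_bij_betw_nat_finite[OF fin] by (auto simp: atLeast0LessThan)
  have hE: "h i \<in> E" if "i < ?n" for i
    using bij_betwE[OF h] that by simp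
  let ?r = "representation E"
  have expand: "(\<Sum>e\<in>E. ?r x e *\<^sub>R e) = x" for x
    using ind E(2) fin by (intro real_vector.sum_representation_eq) auto
  have r_add: "?r (x + y) e = ?r x e + ?r y e" for x y e
    using ind E(2) by (simp add: real_vector.representation_add)
  have r_scale: "?r (c *\<^sub>R x) e = c * ?r x e" for c x e
    using ind E(2) by (simp add: real_vector.representation_scale)
  have r_sum: "?r (\<Sum>e\<in>E. u e *\<^sub>R e) f = u f" if "f \<in> E" for u f
  proof -
    have "?r (\<Sum>e\<in>E. u e *\<^sub>R e) f = (\<Sum>e\<in>E. if e = f then u e else 0)"
      using ind E(2) 
      by (auto simp: real_vector.representation_sum real_vector.representation_scale
          real_vector.representation_basis intro!: sum.cong)
    then show ?thesis using that fin by simp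
  qed
  have r_mult: "?r (m x y) e = ?r x e * ?r y e" if "e \<in> E" for x y e
  proof -
    \<comment> \<open>Multiplication by \<open>e\<close> reads off the coordinate at \<open>e\<close>, so compare \<open>(x y) e\<close> with \<open>x (y e)\<close>.\<close>
    have prod: "m z e = ?r z e *\<^sub>R e" for z
      using m_orthogonal_sum[OF E(1) that, of "?r z"] commutative[of z e] by (simp add: expand)
    have "?r (m x y) e *\<^sub>R e = (?r x e * ?r y e) *\<^sub>R e"
      by (simp add: prod[symmetric] assoc) (simp add: prod m_simps mult.commute)
    moreover have "e \<noteq> 0" using that E(1) by (auto simp: orthogonal_idempotents_def)
    ultimately show ?thesis by simp
  qed
  define \<phi> where "\<phi> x i = (if i < ?n then ?r x (h i) else 0)" for x i
  have "bij_betw \<phi> UNIV (Rn ?n)"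
  proof (rule bij_betwI')
    fix x y
    have "x = y" if "\<phi> x = \<phi> y"
    proof -
      have "?r x e = ?r y e" if "e \<in> E" for e
      proof -
        obtain i where "i < ?n" "e = h i"
          using h \<open>e \<in> E\<close> by (auto simp: bij_betw_def)
        then show ?thesis using fun_cong[OF \<open>\<phi> x = \<phi> y\<close>, of i] by (simp add: \<phi>_def)
      qed
      then have "(\<Sum>e\<in>E. ?r x e *\<^sub>R e) = (\<Sum>e\<in>E. ?r y e *\<^sub>R e)" by simp
      then show ?thesis by (simp only: expand)
    qed
    then show "(\<phi> x = \<phi> y) = (x = y)" by auto
  next
    fix x show "\<phi> x \<in> Rn ?n" by (simp add: \<phi>_def Rn_def)
  next
    fix v assume v: "v \<in> Rn ?n"
    let ?u = "\<lambda>e. v (the_inv_into {..<?n} h e)"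
    have "\<phi> (\<Sum>e\<in>E. ?u e *\<^sub>R e) = v"
    proof
      fix i show "\<phi> (\<Sum>e\<in>E. ?u e *\<^sub>R e) i = v i"
        using v h by (auto simp: \<phi>_def Rn_def r_sum hE the_inv_into_f_f bij_betw_def)
    qed
    then show "\<exists>x\<in>UNIV. v = \<phi> x" by (metis UNIV_I)
  qed
  then show ?thesis
    unfolding isomorphic_to_Rn_def
    by (intro exI[of _ \<phi>]) (auto simp: \<phi>_def fun_eq_iff r_add r_scale r_mult hE)
qed

end

section \<open>Left symmetric algebras with positive definite Koszul form\<close>

lemma left_symmetric_operator_commutator:
  assumes "left_symmetric m"
  shows "m (m x y - m y x) z = m x (m y z) - m y (m x z)"
proof -
  have "bilinear m" "associator m x y z = associator m y x z"
    using assms by (simp_all add: left_symmetric_def fin_dim_algebra_def)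
  then show ?thesis
    by (simp add: associator_def bilinear_lsub) (simp add: algebra_simps)
qed

lemma linear_endo_trace_mult:
  assumes "fin_dim_algebra m"
  shows "linear (\<lambda>x. endo_trace (m x))"
proof -
  have bil: "bilinear m"
    using assms by (simp add: fin_dim_algebra_def)
  obtain F :: "'a set" where F: "finite F" "span F = UNIV"
    using assms by (auto simp: fin_dim_algebra_def)
  have lin: "linear (m x)" for x using bil by (simp add: bilinear_def)
  have "m (x + y) = (\<lambda>z. m x z + m y z)" "m (c *\<^sub>R x) = (\<lambda>z. c *\<^sub>R m x z)" for x y c
    by (simp_all add: fun_eq_iff bilinear_ladd[OF bil] bilinear_lmul[OF bil])
  then show ?thesis
    by (simp add: linear_iff endo_trace_add[OF F lin lin] endo_trace_scaleR[OF F lin])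
qed

text \<open>
  The difference of the two values is the trace of a commutator of left multiplications.
\<close>

lemma koszul_form_commute:
  assumes "left_symmetric m"
  shows "koszul_form m x y = koszul_form m y x"
proof -
  have fd: "fin_dim_algebra m" using assms by (simp add: left_symmetric_def)
  then have bil: "bilinear m" by (simp add: fin_dim_algebra_def)
  obtain F :: "'a set" where F: "finite F" "span F = UNIV"
    using fd by (auto simp: fin_dim_algebra_def)
  have lin: "linear (m z)" for z using bil by (simp add: bilinear_def)
  have lin2: "linear (\<lambda>z. m u (m w z))" for u w
    using linear_compose[OF lin lin] by (simp add: o_def)
  have "m (m x y - m y x) = (\<lambda>z. m x (m y z) + (- 1) *\<^sub>R m y (m x z))"
    by (simp add: fun_eq_iff left_symmetric_operator_commutator[OF assms])
  then have "endo_trace (m (m x y - m y x)) =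
      endo_trace (\<lambda>z. m x (m y z)) - endo_trace (\<lambda>z. m y (m x z))"
    by (simp only:) (subst endo_trace_add[OF F lin2 linear_compose_scale_right[OF lin2]],
        subst endo_trace_scaleR[OF F lin2], simp)
  also have "\<dots> = 0"
    using endo_trace_comp_commute[OF F lin lin] by simp
  finally show ?thesis
    using linear_diff[OF linear_endo_trace_mult[OF fd], of "m x y" "m y x"]
    by (simp add: koszul_form_def)
qed

text \<open>
  Commutativity turns the commutator identity into \<open>x (y z) = y (x z)\<close>, from which associativity
  follows by reordering factors.
\<close>

lemma commutative_left_symmetric_imp_associative:
  assumes "left_symmetric m" "commutative_algebra m"
  shows "associative_algebra m"
proof -
  have fd: "fin_dim_algebra m" and comm: "\<And>x y. m x y = m y x"
    using assms(2) by (auto simp: commutative_algebra_def)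
  then have bil: "bilinear m" by (simp add: fin_dim_algebra_def)
  have left: "m x (m y z) = m y (m x z)" for x y z
    using left_symmetric_operator_commutator[OF assms(1), of x y z] comm[of x y]
    by (simp add: bilinear_lzero[OF bil])
  have "m (m x y) z = m x (m y z)" for x y z
  proof -
    have "m (m x y) z = m z (m x y)" by (rule comm)
    also have "\<dots> = m x (m z y)" by (rule left)
    also have "\<dots> = m x (m y z)" by (simp only: comm[of z y])
    finally show ?thesis .
  qed
  with fd show ?thesis by (simp add: associative_algebra_def)
qed

lemma commutative_associative_imp_novikov:
  assumes "commutative_algebra m" "associative_algebra m"
  shows "novikov_algebra m"
  using assms
  unfolding novikov_algebra_def left_symmetric_def commutative_algebra_def associative_algebra_def
    associator_def
  by metis

text \<open>
  The Novikov identity gives \<open>K (x y) z = trace (L ((x y) z)) = trace (L ((x z) y)) = K (x z) y\<close>.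
  So left multiplications are self-adjoint, and their commutators are both self-adjoint and skew.
\<close>

lemma LSPK_novikov_imp_commutative:
  assumes "LSPK m" "novikov_algebra m"
  shows "commutative_algebra m"
proof -
  let ?K = "koszul_form m"
  have ls: "left_symmetric m" and pos: "\<And>x. x \<noteq> 0 \<Longrightarrow> 0 < ?K x x"
    using assms(1) by (auto simp: LSPK_def)
  have fd: "fin_dim_algebra m" using ls by (simp add: left_symmetric_def)
  then have bil: "bilinear m" by (simp add: fin_dim_algebra_def)
  have nov: "m (m x y) z = m (m x z) y" for x y z
    using assms(2) by (simp add: novikov_algebra_def)
  have self_adjoint: "?K (m x y) z = ?K y (m x z)" for x y z
    using koszul_form_commute[OF ls, of "m x z" y] by (simp add: koszul_form_def nov[of x y z])
  have K_diff: "?K (x - y) z = ?K x z - ?K y z" for x y z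
    using linear_diff[OF linear_endo_trace_mult[OF fd]]
    by (simp add: koszul_form_def bilinear_lsub[OF bil])
  have zero: "x = 0" if "?K x x = 0" for x
    using pos[of x] that by fastforce
  have "m x y = m y x" for x y
  proof -
    define c where "c = m x y - m y x"
    have cz: "m c z = m x (m y z) - m y (m x z)" for z
      unfolding c_def by (rule left_symmetric_operator_commutator[OF ls])
    have skew: "?K (m c z) w = - ?K (m c w) z" for z w
      unfolding cz K_diff
        self_adjoint[of x "m y z" w] self_adjoint[of y "m x z" w]
        self_adjoint[of x "m y w" z] self_adjoint[of y "m x w" z]
      by (simp add: koszul_form_commute[OF ls, of "m x z" "m y w"]
          koszul_form_commute[OF ls, of "m y z" "m x w"])
    have "?K (m c z) w = 0" for z w
      using skew[of z w] self_adjoint[of c z w] koszul_form_commute[OF ls, of z "m c w"] by simp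
    then have "m c c = 0" by (rule zero)
    then have "?K c c = 0"
      using linear_0[OF linear_endo_trace_mult[OF fd]] by (simp add: koszul_form_def)
    then have "c = 0" by (rule zero)
    then show ?thesis by (simp add: c_def)
  qed
  with fd show ?thesis by (simp add: commutative_algebra_def)
qed

lemma LSPK_associative_imp_positive_trace_algebra:
  assumes "LSPK m" "associative_algebra m"
  shows "positive_trace_algebra m (\<lambda>x. endo_trace (m x))"
proof (intro positive_trace_algebra.intro)
  show "fin_dim_algebra m" "m (m x y) z = m x (m y z)" for x y z
    using assms(2) by (simp_all add: associative_algebra_def)
  then show "linear (\<lambda>x. endo_trace (m x))"
    by (simp add: linear_endo_trace_mult)
  show "endo_trace (m (m x y)) = endo_trace (m (m y x))" for x y
    using koszul_form_commute[of m x y] assms(1) by (simp add: LSPK_def koszul_form_def)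
  show "0 < endo_trace (m (m x x))" if "x \<noteq> 0" for x
    using assms(1) that by (simp add: LSPK_def koszul_form_def)
qed

theorem theorem3p1:
  fixes m :: "'a::real_vector \<Rightarrow> 'a \<Rightarrow> 'a"
  assumes "LSPK m"
  shows "(novikov_algebra m \<longleftrightarrow> commutative_algebra m) \<and>
    (commutative_algebra m \<longleftrightarrow> associative_algebra m) \<and>
    (novikov_algebra m \<or> commutative_algebra m \<or> associative_algebra m \<longrightarrow>
      isomorphic_to_Rn m (dim (UNIV :: 'a set)))"
proof -
  have comm_imp_assoc: "commutative_algebra m \<Longrightarrow> associative_algebra m"
    using assms commutative_left_symmetric_imp_associative by (auto simp: LSPK_def)
  have assoc_imp: "commutative_algebra m \<and> isomorphic_to_Rn m (dim (UNIV :: 'a set))"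
    if "associative_algebra m"
  proof -
    interpret positive_trace_algebra m "\<lambda>x. endo_trace (m x)"
      by (rule LSPK_associative_imp_positive_trace_algebra[OF assms that])
    show ?thesis
      using isomorphic_to_Rn commutative fin_dim unfolding commutative_algebra_def by blast
  qed
  show ?thesis
    using comm_imp_assoc assoc_imp LSPK_novikov_imp_commutative[OF assms]
      commutative_associative_imp_novikov by blast
qed

end
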